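(* Let $m\ge 2$ and $D\ge 1$ be integers, and let $T$ be the perfect unrooted $m$-ary tree of diameter $D$. For each integer $d\ge 0$ let $V(d)$ denote the number of vertices in the perfect unrooted $m$-ary tree of diameter $d$. Then, for every integer $t$ with $1\le t\le D$, \[ P(T,t)= \begin{cases} m^{\frac{t-1}{2}}\left(V(D)-V(t-1)\right), & t \text{ odd},\\ \frac{1}{2}(m+1)m^{\frac{t}{2}-1}\left(V(D)-V(t-1)\right), & t \text{ even}. \end{cases} \]
   Context: A tree $T=(V,E)$ is a finite connected acyclic (simple, undirected) graph. The distance $d_T(u,v)$ between vertices $u,v$ is the number of edges in the unique path in $T$ joining $u$ and $v$. For an integer $t\ge 1$, $P(T,t)$ is the number of unordered pairs $\{u,v\}$ of distinct vertices of $T$ with $d_T(u,v)=t$; equivalently, the number of (undirected) paths of length $t$ in $T$. An unrooted $m$-ary tree is a tree in which every vertex has degree $1$ or $m+1$. Its diameter $D$ is the maximum of $d_T(u,v)$ over all pairs of vertices $u,v$. It is called perfect if and only if every degree-$1$ vertex is at distance $D$ from some other vertex. For each $D\ge 1$ there is, up to isomorphism, exactly one perfect unrooted $m$-ary tree of diameter $D$; by convention, the perfect unrooted $m$-ary tree of diameter $0$ is the single-vertex tree, so $V(0)=1$. *)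

theory Defs
  imports Complex_Main "Graph_Theory.Graph_Theory"
begin

text \<open>
  A finite simple undirected graph is a \<open>pair_graph\<close>: a finite, loop-free, symmetric digraph without
  parallel arcs, each undirected edge being represented by its two orientations.  The constant
  \<open>tree\<close> of the library is not usable here: with respect to its notion of cycle, the walk
  \<open>a, b, a\<close> along a single undirected edge is a cycle.  The cycles of the undirected graph are those
  library cycles that have at least three arcs.
\<close>

definition undirected_tree :: "'a pair_pre_digraph \<Rightarrow> bool" where
  "undirected_tree T \<longleftrightarrow>
     pair_graph T \<and> connected (with_proj T) \<and>
     \<not> (\<exists>p. pre_digraph.cycle (with_proj T) p \<and> length p \<ge> 3)"

text \<open>By symmetry, the out-degree is the degree in the undirected graph.\<close>

abbreviation vert_degree :: "'a pair_pre_digraph \<Rightarrow> 'a \<Rightarrow> nat" where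
  "vert_degree T v \<equiv> out_degree (with_proj T) v"

definition tree_dist :: "'a pair_pre_digraph \<Rightarrow> 'a \<Rightarrow> 'a \<Rightarrow> nat" where
  "tree_dist T u v = length (THE p. pre_digraph.apath (with_proj T) u p v)"

definition tree_diameter :: "'a pair_pre_digraph \<Rightarrow> nat" where
  "tree_diameter T = Max {tree_dist T u v | u v. u \<in> pverts T \<and> v \<in> pverts T}"

definition path_count :: "'a pair_pre_digraph \<Rightarrow> nat \<Rightarrow> nat" where
  "path_count T t =
     card {{u, v} | u v. u \<in> pverts T \<and> v \<in> pverts T \<and> u \<noteq> v \<and> tree_dist T u v = t}"

definition unrooted_mary_tree :: "nat \<Rightarrow> 'a pair_pre_digraph \<Rightarrow> bool" where
  "unrooted_mary_tree m T \<longleftrightarrow>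
     undirected_tree T \<and> (\<forall>v\<in>pverts T. vert_degree T v = 1 \<or> vert_degree T v = m + 1)"

definition perfect_unrooted_mary_tree :: "nat \<Rightarrow> 'a pair_pre_digraph \<Rightarrow> bool" where
  "perfect_unrooted_mary_tree m T \<longleftrightarrow>
     unrooted_mary_tree m T \<and>
     (\<forall>v\<in>pverts T. vert_degree T v = 1 \<longrightarrow>
        (\<exists>w\<in>pverts T. w \<noteq> v \<and> tree_dist T v w = tree_diameter T))"

text \<open>
  The single-vertex tree has a vertex of degree 0, so it is not an unrooted m-ary tree; by
  convention it is the perfect one of diameter 0.
\<close>

definition perfect_mary_tree_of_diameter :: "nat \<Rightarrow> nat \<Rightarrow> 'a pair_pre_digraph \<Rightarrow> bool" where
  "perfect_mary_tree_of_diameter m d T \<longleftrightarrow>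
     (if d = 0 then undirected_tree T \<and> card (pverts T) = 1
      else perfect_unrooted_mary_tree m T \<and> tree_diameter T = d)"

text \<open>
  The number V(d).  As the trees are finite, it is no restriction to take the vertices from the
  natural numbers; the description is proper because the perfect tree of diameter d exists and is
  unique up to isomorphism.
\<close>

definition perfect_mary_order :: "nat \<Rightarrow> nat \<Rightarrow> nat" where
  "perfect_mary_order m d =
     (THE n. \<exists>T :: nat pair_pre_digraph. perfect_mary_tree_of_diameter m d T \<and> card (pverts T) = n)"

end

theory Submission
  imports Defs
begin

text \<open>
  Remove all leaves from the perfect tree of diameter \<open>D \<ge> 2\<close>.  What remains, the interior, is the
  perfect tree of diameter \<open>D - 2\<close> (\<open>perfect_interior\<close>).  This has two consequences.
  
  First, the handshake count \<open>\<Sum> deg = 2 (V(D) - 1)\<close>, with degree \<open>m + 1\<close> in the interior and 1 at the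
  leaves, gives \<open>V(D) = m V(D - 2) + 2\<close>; together with \<open>V(0) = 1\<close> and \<open>V(1) = 2\<close> this determines
  \<open>V\<close>.
  
  Second, a path of length \<open>t + 2\<close> with \<open>t \<ge> 1\<close> arises from a path of length \<open>t\<close> in the interior by
  prolonging it at both ends.  An end is an interior vertex, hence has \<open>m + 1\<close> neighbours, and one of
  them is on the path already; so there are \<open>m\<close> ways at each end, and
  \<open>P(D, t + 2) = m^2 P(D - 2, t)\<close> (\<open>card_pairs_at_interior\<close>).  Since
  \<open>V(D) - V(t + 1) = m (V(D - 2) - V(t - 1))\<close>, the claimed formula satisfies the same recursion
  (\<open>card_pairs_at_perfect\<close>).  It remains to look at \<open>t = 1\<close>, where \<open>P\<close> is the number \<open>V(D) - 1\<close> of edges,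
  and at \<open>t = 2\<close>, where each of the \<open>(V(D) - 2) / m\<close> interior vertices is the middle of
  \<open>(m + 1) m / 2\<close> paths.
  
  All of this is carried out for the distance function alone, axiomatised as a \<open>tree_metric\<close>: from any
  vertex exactly one neighbour is closer to a given other vertex.  The distance in a tree has this
  property (\<open>tree_dist_arc_cases\<close>) because acyclicity makes paths unique.  Conversely, every tree metric is the
  distance in a tree (\<open>tree_dist_adjacency_graph\<close>).  The converse is used for the existence of the
  perfect tree of each diameter, on which the definition of \<open>V\<close> depends: it is obtained from the one of
  diameter \<open>D - 2\<close> by attaching leaves, and this is easier to do on metrics (\<open>perfect_attach\<close>).
\<close>

section \<open>Tree metrics\<close>

text \<open>
  A tree is determined by its distance function, and the one feature of that function that all the
  counting uses is \<open>toward\<close> with \<open>step\<close>: seen from a vertex \<open>u \<noteq> v\<close>, exactly one neighbour of \<open>u\<close> is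
  closer to \<open>v\<close>, namely the next vertex on the path, and all others are one step farther.  Working with
  the pair \<open>(V, d)\<close> instead of a graph has the advantage that removing the leaves leaves \<open>d\<close> unchanged
  and only shrinks \<open>V\<close>.
\<close>

locale tree_metric =
  fixes V :: "'a set" and d :: "'a \<Rightarrow> 'a \<Rightarrow> nat"
  assumes finite_V: "finite V"
    and nonempty: "V \<noteq> {}"
    and dist_refl: "v \<in> V \<Longrightarrow> d v v = 0"
    and dist_sym: "u \<in> V \<Longrightarrow> v \<in> V \<Longrightarrow> d u v = d v u"
    and toward: "u \<in> V \<Longrightarrow> v \<in> V \<Longrightarrow> u \<noteq> v \<Longrightarrow> \<exists>!w. w \<in> V \<and> d u w = 1 \<and> d u v = d w v + 1"
    and step: "u \<in> V \<Longrightarrow> v \<in> V \<Longrightarrow> w \<in> V \<Longrightarrow> d u w = 1 \<Longrightarrow>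
                 d w v = d u v + 1 \<or> d u v = d w v + 1"
begin

lemma dist_eq_0: "u \<in> V \<Longrightarrow> v \<in> V \<Longrightarrow> d u v = 0 \<longleftrightarrow> u = v"
  using toward[of u v] dist_refl by fastforce

definition nbrs :: "'a \<Rightarrow> 'a set" where
  "nbrs v = {w \<in> V. d v w = 1}"

lemma finite_nbrs [simp]: "finite (nbrs v)"
  using finite_V by (simp add: nbrs_def)

lemma nbrs_sym: "u \<in> V \<Longrightarrow> w \<in> nbrs u \<Longrightarrow> u \<in> nbrs w"
  using dist_sym by (simp add: nbrs_def)

lemma nbrs_in_V: "w \<in> nbrs u \<Longrightarrow> w \<in> V"
  by (simp add: nbrs_def)

lemma obtain_toward:
  assumes "u \<in> V" "v \<in> V" "u \<noteq> v"
  obtains w where "w \<in> nbrs u" "d u v = d w v + 1"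
    "\<And>x. x \<in> nbrs u \<Longrightarrow> x \<noteq> w \<Longrightarrow> d x v = d u v + 1"
proof -
  obtain w where w: "w \<in> V \<and> d u w = 1 \<and> d u v = d w v + 1"
    and uniq: "\<And>x. x \<in> V \<and> d u x = 1 \<and> d u v = d x v + 1 \<Longrightarrow> x = w"
    using toward[OF assms] by metis
  show ?thesis
  proof (rule that)
    show "w \<in> nbrs u" "d u v = d w v + 1" using w by (auto simp: nbrs_def)
    show "d x v = d u v + 1" if "x \<in> nbrs u" "x \<noteq> w" for x
      using that step[OF assms(1,2), of x] uniq[of x] by (auto simp: nbrs_def)
  qed
qed

lemma ex_toward:
  assumes "u \<in> V" "v \<in> V" "u \<noteq> v"
  shows "\<exists>w\<in>nbrs u. d u v = d w v + 1"
  by (rule obtain_toward[OF assms]) blast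

lemma card_nbrs_away:
  assumes "u \<in> V" "v \<in> V" "u \<noteq> v"
  shows "card {x \<in> nbrs u. d x v = d u v + 1} = card (nbrs u) - 1"
proof -
  obtain w where w: "w \<in> nbrs u" "d u v = d w v + 1"
    "\<And>x. x \<in> nbrs u \<Longrightarrow> x \<noteq> w \<Longrightarrow> d x v = d u v + 1"
    using obtain_toward[OF assms] by blast
  have "x \<in> nbrs u \<and> d x v = d u v + 1 \<longleftrightarrow> x \<in> nbrs u \<and> x \<noteq> w" for x
    using w(2) w(3)[of x] by auto
  then have "{x \<in> nbrs u. d x v = d u v + 1} = nbrs u - {w}"
    by blast
  then show ?thesis using w(1) by simp
qed

lemma two_nbrs:
  assumes "x \<in> nbrs v" "y \<in> nbrs v" "x \<noteq> y"
  shows "2 \<le> card (nbrs v)"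
  using card_mono[of "nbrs v" "{x, y}"] assms by simp

lemma extend_away:
  assumes "u \<in> V" "v \<in> V" "2 \<le> card (nbrs u)"
  obtains x where "x \<in> nbrs u" "d x v = d u v + 1"
proof (cases "u = v")
  case True
  from assms(3) obtain x where "x \<in> nbrs u"
    by (metis card.empty equals0I not_numeral_le_zero)
  then show ?thesis
    using that True assms dist_refl dist_sym by (auto simp: nbrs_def)
next
  case False
  then have "card {x \<in> nbrs u. d x v = d u v + 1} \<noteq> 0"
    using card_nbrs_away[of u v] assms by simp
  then show ?thesis using that by (metis (mono_tags, lifting) card.empty empty_Collect_eq)
qed

lemma nbrs_nonempty:
  assumes "u \<in> V" "v \<in> V" "u \<noteq> v"
  shows "0 < card (nbrs u)"
  using ex_toward[OF assms] by (auto simp: card_gt_0_iff)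

text \<open>
  The only neighbour of a leaf lies on every path that starts at the leaf.
\<close>

lemma leaf_nbr_dist:
  assumes "x \<in> V" "v \<in> nbrs x" "card (nbrs x) \<le> 1" "w \<in> V" "w \<noteq> x"
  shows "d x w = d v w + 1"
proof -
  obtain y where y: "y \<in> nbrs x" "d x w = d y w + 1" using ex_toward[of x w] assms by auto
  then have "y = v" using two_nbrs[of y x v] assms by linarith
  then show ?thesis using y by simp
qed

text \<open>
  The handshake count of a tree: fix a root \<open>r\<close>.  Every vertex other than \<open>r\<close> has exactly one
  neighbour closer to \<open>r\<close>, so \<open>card V - 1\<close> of the ordered adjacent pairs point toward the root, and
  reversal matches them with the pairs that point away from it.
\<close>

lemma sum_degrees: "(\<Sum>v\<in>V. card (nbrs v)) = 2 * (card V - 1)"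
proof -
  obtain r where r: "r \<in> V" using nonempty by auto
  define A where "A = (SIGMA v : V. nbrs v)"
  define up where "up = {(u, w). u \<in> V \<and> w \<in> nbrs u \<and> d u r = d w r + 1}"
  have fin: "finite A" using finite_V by (auto simp: A_def)
  have "A = up \<union> prod.swap ` up"
  proof
    show "A \<subseteq> up \<union> prod.swap ` up"
    proof
      fix x assume "x \<in> A"
      then obtain u w where x: "x = (u, w)" "u \<in> V" "w \<in> nbrs u" by (auto simp: A_def)
      then have w: "w \<in> V" "u \<in> nbrs w" using nbrs_in_V nbrs_sym by blast+
      have "d w r = d u r + 1 \<or> d u r = d w r + 1"
        using step[of u r w] x r by (simp add: nbrs_def)
      then have "(u, w) \<in> up \<or> (w, u) \<in> up" using x w by (auto simp: up_def)
      then show "x \<in> up \<union> prod.swap ` up"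
        using x(1) by (auto intro: image_eqI[of _ _ "(w, u)"])
    qed
    show "up \<union> prod.swap ` up \<subseteq> A"
      by (auto simp: A_def up_def intro: nbrs_sym dest: nbrs_in_V)
  qed
  moreover have "up \<inter> prod.swap ` up = {}" by (auto simp: up_def)
  ultimately have "card A = card up + card (prod.swap ` up)"
    using fin card_Un_disjoint[of up "prod.swap ` up"] by (metis finite_Un)
  also have "card (prod.swap ` up) = card up" by (rule card_image) auto
  also have "card up = card (fst ` up)"
  proof (rule card_image[symmetric], rule inj_onI)
    fix x y assume xy: "x \<in> up" "y \<in> up" "fst x = fst y"
    obtain u w w' where e: "x = (u, w)" "y = (u, w')" using xy(3) by (cases x, cases y) auto
    have "u \<in> V" "u \<noteq> r" using xy e dist_refl[OF r] by (auto simp: up_def)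
    then show "x = y" using toward[of u r] r xy e by (auto simp: up_def nbrs_def)
  qed
  also have "fst ` up = V - {r}"
  proof
    show "fst ` up \<subseteq> V - {r}" using dist_refl[OF r] by (auto simp: up_def)
    show "V - {r} \<subseteq> fst ` up"
    proof
      fix u assume u: "u \<in> V - {r}"
      then obtain w where "w \<in> nbrs u" "d u r = d w r + 1" using ex_toward[of u r] r by auto
      then show "u \<in> fst ` up" using u by (auto simp: up_def intro!: image_eqI[of _ _ "(u, w)"])
    qed
  qed
  also have "card (V - {r}) = card V - 1" using r by simp
  finally show ?thesis using finite_V by (simp add: A_def)
qed

definition interior :: "'a set" where
  "interior = {v \<in> V. 2 \<le> card (nbrs v)}"

lemma finite_interior: "finite interior" using finite_V by (simp add: interior_def)

text \<open>
  A vertex \<open>x\<close> at distance \<open>s + 1\<close> from \<open>v\<close> is reached through a unique \<open>u\<close> at distance \<open>s\<close>.  As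
  \<open>s \<ge> 1\<close>, this \<open>u\<close> has a second neighbour, the one toward \<open>v\<close>, so it is interior; of its \<open>m + 1\<close>
  neighbours all but that one are farther from \<open>v\<close>.
\<close>

lemma card_sphere_Suc:
  assumes deg: "\<And>u. u \<in> interior \<Longrightarrow> card (nbrs u) = m + 1"
    and v: "v \<in> V" and s: "1 \<le> s"
  shows "card {x \<in> V. d x v = s + 1} = m * card {u \<in> interior. d u v = s}"
proof -
  let ?U = "{u \<in> interior. d u v = s}"
  have "{x \<in> V. d x v = s + 1} = (\<Union>u\<in>?U. {x \<in> nbrs u. d x v = d u v + 1})" (is "?L = ?R")
  proof
    show "?R \<subseteq> ?L" by (auto simp: nbrs_def)
    show "?L \<subseteq> ?R"
    proof
      fix x assume "x \<in> ?L"
      then have x: "x \<in> V" "d x v = s + 1" by auto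
      then obtain u where u: "u \<in> nbrs x" "d x v = d u v + 1"
        using ex_toward[of x v] v dist_refl[OF v] by fastforce
      then have uV: "u \<in> V" "x \<in> nbrs u" "d u v = s" using nbrs_sym[of x u] x nbrs_in_V[of u x] by simp_all
      then obtain w where w: "w \<in> nbrs u" "d u v = d w v + 1"
        using ex_toward[of u v] v dist_refl[OF v] s by fastforce
      have "w \<noteq> x" using w u by auto
      then have "u \<in> interior" using two_nbrs[of w u x] w uV by (simp add: interior_def)
      then show "x \<in> ?R" using uV u by auto
    qed
  qed
  moreover have "card ?R = (\<Sum>u\<in>?U. card {x \<in> nbrs u. d x v = d u v + 1})"
  proof (rule card_UN_disjoint)
    show "\<forall>u\<in>?U. \<forall>u'\<in>?U. u \<noteq> u' \<longrightarrow>
        {x \<in> nbrs u. d x v = d u v + 1} \<inter> {x \<in> nbrs u'. d x v = d u' v + 1} = {}"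
    proof (intro ballI impI, rule ccontr)
      fix u u' assume u: "u \<in> ?U" "u' \<in> ?U" "u \<noteq> u'"
        and "{x \<in> nbrs u. d x v = d u v + 1} \<inter> {x \<in> nbrs u'. d x v = d u' v + 1} \<noteq> {}"
      then obtain x where x: "x \<in> nbrs u" "x \<in> nbrs u'" "d x v = s + 1" by auto
      have V: "u \<in> V" "u' \<in> V" "d u v = s" "d u' v = s" using u by (auto simp: interior_def)
      have "x \<in> V" using nbrs_in_V[OF x(1)] .
      moreover have "u \<in> nbrs x" "u' \<in> nbrs x" using V nbrs_sym x by blast+
      moreover have "x \<noteq> v" using x(3) dist_refl[OF v] by auto
      ultimately show False using toward[of x v] u(3) V x(3) v by (auto simp: nbrs_def)
    qed
  qed (use finite_interior in auto)
  moreover have "card {x \<in> nbrs u. d x v = d u v + 1} = m" if "u \<in> ?U" for u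
  proof -
    have "u \<in> V" "u \<noteq> v" using that s dist_refl[OF v] by (auto simp: interior_def)
    then show ?thesis using card_nbrs_away[of u v] deg[of u] that v by simp
  qed
  ultimately show ?thesis by simp
qed

end

context tree_metric begin

lemma interior_subset: "interior \<subseteq> V"
  by (auto simp: interior_def)

text \<open>
  Only \<open>toward\<close> needs an argument: the next vertex on the path from \<open>u\<close> to \<open>v\<close> either is \<open>v\<close> or has
  both a predecessor and a successor on that path, so it is interior again.
\<close>

lemma tree_metric_interior:
  assumes "interior \<noteq> {}"
  shows "tree_metric interior d"
proof
  show "finite interior" by (rule finite_interior)
  show "interior \<noteq> {}" by (rule assms)
  show "d v v = 0" if "v \<in> interior" for v using that dist_refl by (simp add: interior_def)
  show "d u v = d v u" if "u \<in> interior" "v \<in> interior" for u v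
    using that dist_sym by (simp add: interior_def)
  show "d w v = d u v + 1 \<or> d u v = d w v + 1"
    if "u \<in> interior" "v \<in> interior" "w \<in> interior" "d u w = 1" for u v w
    using that step by (simp add: interior_def)
  show "\<exists>!w. w \<in> interior \<and> d u w = 1 \<and> d u v = d w v + 1"
    if uv: "u \<in> interior" "v \<in> interior" "u \<noteq> v" for u v
  proof -
    have V: "u \<in> V" "v \<in> V" using uv by (auto simp: interior_def)
    obtain w where w: "w \<in> nbrs u" "d u v = d w v + 1" using ex_toward[OF V uv(3)] by blast
    have wV: "w \<in> V" and uw: "u \<in> nbrs w" using w(1) V nbrs_in_V nbrs_sym by blast+
    have "w \<in> interior"
    proof (cases "w = v")
      case False
      then obtain x where x: "x \<in> nbrs w" "d w v = d x v + 1" using ex_toward[OF wV V(2)] by blast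
      then have "x \<noteq> u" using w by auto
      then show ?thesis using two_nbrs[OF x(1) uw] wV by (simp add: interior_def)
    qed (use uv in simp)
    then show ?thesis using w toward[OF V uv(3)] interior_subset by (auto simp: nbrs_def)
  qed
qed

end

section \<open>Perfect trees and the removal of their leaves\<close>

text \<open>
  The last condition treats all diameters alike: the leaves of a perfect tree have degree 1 for
  \<open>D \<ge> 1\<close>, while the single vertex of the tree of diameter 0 has degree 0.  Allowing both by
  \<open>card (nbrs v) \<le> 1\<close> lets the removal of the leaves descend to diameter 0 without a special case.
\<close>

locale perfect_tree_metric = tree_metric +
  fixes m D :: nat
  assumes two_le_m: "2 \<le> m"
    and bounded: "u \<in> V \<Longrightarrow> v \<in> V \<Longrightarrow> d u v \<le> D"
    and attained: "\<exists>u\<in>V. \<exists>v\<in>V. d u v = D"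
    and degrees: "v \<in> V \<Longrightarrow>
      card (nbrs v) = m + 1 \<or> card (nbrs v) \<le> 1 \<and> (\<exists>w\<in>V. d v w = D)"
begin

lemma interior_degree: "u \<in> interior \<Longrightarrow> card (nbrs u) = m + 1"
  using degrees[of u] by (auto simp: interior_def)

lemma leaf_degree: "v \<in> V \<Longrightarrow> v \<notin> interior \<Longrightarrow> card (nbrs v) \<le> 1"
  by (auto simp: interior_def)

lemma end_degree:
  assumes "u \<in> V" "v \<in> V" "d u v = D"
  shows "card (nbrs u) \<le> 1"
proof (rule ccontr)
  assume "\<not> card (nbrs u) \<le> 1"
  then have "2 \<le> card (nbrs u)" by simp
  then obtain x where x: "x \<in> nbrs u" "d x v = d u v + 1" by (rule extend_away[OF assms(1,2)])
  then show False using bounded[OF nbrs_in_V[OF x(1)] assms(2)] assms(3) by simp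
qed

text \<open>
  A path between interior vertices can be prolonged at both of its ends.
\<close>

lemma interior_dist:
  assumes "u \<in> interior" "v \<in> interior"
  shows "d u v + 2 \<le> D"
proof -
  have V: "u \<in> V" "v \<in> V" and two: "2 \<le> card (nbrs u)" "2 \<le> card (nbrs v)"
    using assms by (auto simp: interior_def)
  obtain x where x: "x \<in> nbrs u" "d x v = d u v + 1" using extend_away[OF V two(1)] .
  have xV: "x \<in> V" using x nbrs_in_V by blast
  obtain y where y: "y \<in> nbrs v" "d y x = d v x + 1" using extend_away[OF V(2) xV two(2)] .
  have "y \<in> V" using y nbrs_in_V by blast
  then show ?thesis using bounded[OF _ xV, of y] y x dist_sym[OF V(2) xV] by simp
qed

lemma nbr_of_end_interior:
  assumes V: "u \<in> V" "v \<in> V" and "d u v = D" "2 \<le> D" and w: "w \<in> nbrs u" "d u v = d w v + 1"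
  shows "w \<in> interior"
proof -
  have wV: "w \<in> V" "u \<in> nbrs w" using w V nbrs_in_V nbrs_sym by blast+
  have "w \<noteq> v" using w assms dist_refl by auto
  then obtain x where x: "x \<in> nbrs w" "d w v = d x v + 1" using ex_toward[OF wV(1) V(2)] by blast
  have "x \<noteq> u" using x w by auto
  then show ?thesis using two_nbrs[OF x(1) wV(2)] wV by (simp add: interior_def)
qed

text \<open>
  Removing the leaves of a perfect tree gives a perfect tree whose diameter is smaller by 2.  A
  longest path loses both of its ends.  The delicate point is the degree in the smaller tree
  of an interior vertex \<open>v\<close> that had a leaf \<open>x\<close> as a neighbour.  The leaf \<open>x\<close> begins a path of length
  \<open>D\<close> through \<open>v\<close>; if \<open>v\<close> had an interior neighbour off this path, then going to that neighbour instead
  of \<open>x\<close> and one step beyond it would give a path of length \<open>D + 1\<close>.  So \<open>v\<close> keeps at most one neighbour,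
  and the rest of the path, without its other end, shows that \<open>v\<close> is the end of a longest path in the
  smaller tree.
\<close>

lemma perfect_interior:
  assumes D: "2 \<le> D"
  shows "perfect_tree_metric interior d m (D - 2)"
proof -
  obtain a b where ab: "a \<in> V" "b \<in> V" "d a b = D" using attained by blast
  have "a \<noteq> b" using ab D dist_refl by auto
  then obtain a' where a': "a' \<in> nbrs a" "d a b = d a' b + 1" using ex_toward ab by blast
  have a'I: "a' \<in> interior" using nbr_of_end_interior ab a' D by blast
  have ne: "interior \<noteq> {}" using a'I by auto
  interpret I: tree_metric interior d by (rule tree_metric_interior[OF ne])
  have Inbrs: "I.nbrs v = nbrs v \<inter> interior" if "v \<in> interior" for v
    using interior_subset by (auto simp: I.nbrs_def nbrs_def)
  show ?thesis
  proof
    show "2 \<le> m" by (rule two_le_m)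
    show "d u v \<le> D - 2" if "u \<in> interior" "v \<in> interior" for u v
      using interior_dist[OF that] by simp
    \<comment> \<open>cutting both ends off a longest path from \<open>x\<close> to \<open>w\<close> leaves a longest path from \<open>v\<close>\<close>
    have inward: "\<exists>w'\<in>interior. d v w' = D - 2"
      if x: "x \<in> V" "w \<in> V" "d x w = D" and v: "v \<in> nbrs x" "d x w = d v w + 1" for x v w
    proof -
      have vI: "v \<in> interior" using nbr_of_end_interior x v D by blast
      then have vV: "v \<in> V" using interior_subset by blast
      have wx: "w \<noteq> x" "d w x = D" using x D dist_refl dist_sym by auto
      then obtain w' where w': "w' \<in> nbrs w" "d w x = d w' x + 1" using ex_toward x by blast
      have w'I: "w' \<in> interior" using nbr_of_end_interior[OF x(2,1)] w' wx D by blast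
      then have w'V: "w' \<in> V" using interior_subset by blast
      have "d v w \<noteq> 0" using v x D by auto
      then have "w \<noteq> v" using dist_refl[OF vV] by auto
      have "d x w' = d v w' + 1 \<or> d v w' = d x w' + 1"
        using step[OF x(1) w'V vV] v(1) by (auto simp: nbrs_def)
      moreover have "d v w' + 2 \<le> D" using interior_dist[OF vI w'I] .
      moreover have "d x w' + 1 = D" using w' wx dist_sym[OF x(1) w'V] by simp
      ultimately have "d v w' = D - 2" by linarith
      then show ?thesis using w'I by blast
    qed
    show "\<exists>u\<in>interior. \<exists>v\<in>interior. d u v = D - 2"
      using inward[OF ab a'] a'I by blast
    show "card (I.nbrs v) = m + 1 \<or> card (I.nbrs v) \<le> 1 \<and> (\<exists>w\<in>interior. d v w = D - 2)"
      if vI: "v \<in> interior" for v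
    proof (cases "nbrs v \<subseteq> interior")
      case True
      then show ?thesis using Inbrs[OF vI] interior_degree[OF vI] by (simp add: Int_absorb2)
    next
      case False
      have vV: "v \<in> V" using vI interior_subset by blast
      obtain x where x: "x \<in> nbrs v" "x \<notin> interior" using False by blast
      have xV: "x \<in> V" and vx: "v \<in> nbrs x" using x vV nbrs_in_V nbrs_sym by blast+
      have leaf: "card (nbrs x) \<le> 1" using leaf_degree xV x by blast
      then obtain w where w: "w \<in> V" "d x w = D" using degrees[OF xV] two_le_m by auto
      have "w \<noteq> x" using w D dist_refl by auto
      then have dv: "d x w = d v w + 1" using leaf_nbr_dist[OF xV vx leaf] w by blast
      then have "v \<noteq> w" using w D dist_refl by auto
      then obtain z where z: "z \<in> nbrs v" "d v w = d z w + 1"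
        "\<And>y. y \<in> nbrs v \<Longrightarrow> y \<noteq> z \<Longrightarrow> d y w = d v w + 1"
        using obtain_toward[OF vV w(1)] by blast
      have "y = z" if y: "y \<in> nbrs v \<inter> interior" for y
      proof (rule ccontr)
        assume "y \<noteq> z"
        then have "d y w = D" using z(3)[of y] y dv w by auto
        moreover have "y \<in> V" "2 \<le> card (nbrs y)" using y by (auto simp: interior_def)
        ultimately show False using end_degree[of y w] w(1) by simp
      qed
      then have "I.nbrs v \<subseteq> {z}" using Inbrs[OF vI] by blast
      then have "card (I.nbrs v) \<le> 1" using card_mono[of "{z}"] by simp
      then show ?thesis using inward[OF xV w vx dv] by blast
    qed
  qed
qed

text \<open>
  Comparing the degree sum \<open>2 (card V - 1)\<close> with \<open>m + 1\<close> for each interior vertex and 1 for each leaf.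
\<close>

lemma card_eq:
  assumes D: "1 \<le> D"
  shows "card V = m * card interior + 2"
proof -
  obtain a b where ab: "a \<in> V" "b \<in> V" "d a b = D" using attained by blast
  have "a \<noteq> b" using ab D dist_refl by auto
  then have two: "2 \<le> card V" using card_mono[OF finite_V, of "{a, b}"] ab by simp
  have pos: "0 < card (nbrs v)" if "v \<in> V" for v
    using nbrs_nonempty[OF that ab(1)] nbrs_nonempty[OF that ab(2)] \<open>a \<noteq> b\<close> by blast
  have "2 * (card V - 1) = (\<Sum>v\<in>V. card (nbrs v))" by (simp add: sum_degrees)
  also have "\<dots> = (\<Sum>v\<in>V - interior. card (nbrs v)) + (\<Sum>v\<in>interior. card (nbrs v))"
    by (rule sum.subset_diff[OF interior_subset finite_V])
  also have "(\<Sum>v\<in>V - interior. card (nbrs v)) = (\<Sum>v\<in>V - interior. 1)"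
    by (rule sum.cong) (use pos leaf_degree le_antisym in fastforce)+
  also have "(\<Sum>v\<in>interior. card (nbrs v)) = (m + 1) * card interior"
    using interior_degree by simp
  finally have "2 * (card V - 1) = card V - card interior + (m + 1) * card interior"
    using card_Diff_subset[OF finite_interior interior_subset] by simp
  moreover have "card interior \<le> card V" by (rule card_mono[OF finite_V interior_subset])
  ultimately show ?thesis using two by simp
qed

lemma interior_empty: "D \<le> 1 \<Longrightarrow> interior = {}"
  using interior_dist by fastforce

end

text \<open>
  The recurrence that \<open>card_eq\<close> and \<open>perfect_interior\<close> impose on the order of a perfect tree of diameter
  \<open>D\<close> over \<open>m\<close>.
\<close>

fun perfect_size :: "nat \<Rightarrow> nat \<Rightarrow> nat" where
  "perfect_size m 0 = 1"
| "perfect_size m (Suc 0) = 2"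
| "perfect_size m (Suc (Suc n)) = m * perfect_size m n + 2"

lemma card_perfect:
  "perfect_tree_metric V d m D \<Longrightarrow> card V = perfect_size m D"
proof (induction m D arbitrary: V rule: perfect_size.induct)
  case (1 m)
  interpret perfect_tree_metric V d m 0 by (rule 1)
  obtain a where a: "a \<in> V" using nonempty by auto
  have "v = a" if "v \<in> V" for v using bounded[OF that a] dist_eq_0[OF that a] by simp
  then have "V = {a}" using a by blast
  then show ?case by simp
next
  case (2 m)
  interpret perfect_tree_metric V d m "Suc 0" by (rule 2)
  show ?case using card_eq interior_empty by simp
next
  case (3 m n)
  interpret perfect_tree_metric V d m "Suc (Suc n)" by (rule 3)
  show ?case using card_eq 3(1)[of interior] perfect_interior by simp
qed

section \<open>Counting pairs at a given distance\<close>

definition pairs_at :: "'a set \<Rightarrow> ('a \<Rightarrow> 'a \<Rightarrow> nat) \<Rightarrow> nat \<Rightarrow> ('a \<times> 'a) set" where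
  "pairs_at V d t = {(u, v). u \<in> V \<and> v \<in> V \<and> d u v = t}"

lemma card_pairs_between:
  assumes "finite A" "finite B"
  shows "card {(u, v). u \<in> A \<and> v \<in> B \<and> P u v} = (\<Sum>u\<in>A. card {v \<in> B. P u v})"
proof -
  have "{(u, v). u \<in> A \<and> v \<in> B \<and> P u v} = (SIGMA u : A. {v \<in> B. P u v})" by auto
  then show ?thesis using assms by simp
qed

context perfect_tree_metric begin

text \<open>
  The extension of paths at one end, summed over their other ends \<open>v\<close>.  The set \<open>W\<close> is \<open>V\<close> for the first
  end of a path and \<open>interior\<close> for the second.
\<close>

lemma card_pairs_extend:
  assumes W: "W \<subseteq> V" and s: "1 \<le> s"
  shows "card {(v, x). v \<in> W \<and> x \<in> V \<and> d v x = s + 1}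
       = m * card {(v, u). v \<in> W \<and> u \<in> interior \<and> d v u = s}"
proof -
  have fW: "finite W" using W finite_V finite_subset by blast
  have "card {x \<in> V. d v x = s + 1} = m * card {u \<in> interior. d v u = s}" if "v \<in> W" for v
  proof -
    have v: "v \<in> V" using that W by blast
    have "{x \<in> V. d v x = s + 1} = {x \<in> V. d x v = s + 1}" using dist_sym v by auto
    moreover have "{u \<in> interior. d v u = s} = {u \<in> interior. d u v = s}"
      using dist_sym v by (auto simp: interior_def)
    ultimately show ?thesis using card_sphere_Suc[OF interior_degree v s] by simp
  qed
  then show ?thesis
    using fW finite_V finite_interior by (simp add: card_pairs_between sum_distrib_left)
qed

lemma card_pairs_swap:
  assumes "A \<subseteq> V" "B \<subseteq> V"
  shows "card {(u, v). u \<in> A \<and> v \<in> B \<and> d u v = s} = card {(v, u). v \<in> B \<and> u \<in> A \<and> d v u = s}"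
proof -
  have sym: "d u v = d v u" if "u \<in> A" "v \<in> B" for u v using that assms dist_sym by blast
  have "bij_betw prod.swap {(u, v). u \<in> A \<and> v \<in> B \<and> d u v = s} {(v, u). v \<in> B \<and> u \<in> A \<and> d v u = s}"
    by (rule bij_betw_byWitness[of _ prod.swap]) (use sym in auto)
  then show ?thesis by (rule bij_betw_same_card)
qed

lemma card_pairs_at_Suc:
  assumes "1 \<le> t"
  shows "card (pairs_at V d (t + 1)) = m * card {(u, x). u \<in> interior \<and> x \<in> V \<and> d u x = t}"
  unfolding pairs_at_def
  using card_pairs_extend[OF subset_refl assms] card_pairs_swap[OF subset_refl interior_subset, of t]
  by simp

lemma card_pairs_at_1: "card (pairs_at V d 1) = 2 * (card V - 1)"
  using sum_degrees finite_V by (simp add: pairs_at_def card_pairs_between nbrs_def)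

lemma card_pairs_at_2: "card (pairs_at V d 2) = m * ((m + 1) * card interior)"
proof -
  have "card {(u, x). u \<in> interior \<and> x \<in> V \<and> d u x = 1} = (\<Sum>u\<in>interior. card (nbrs u))"
    using finite_interior finite_V by (simp add: card_pairs_between nbrs_def)
  also have "\<dots> = (m + 1) * card interior" using interior_degree by simp
  finally show ?thesis using card_pairs_at_Suc[of 1] by (simp add: numeral_2_eq_2)
qed

text \<open>
  Deleting both end vertices maps the paths of length \<open>t + 2\<close> onto the paths of length \<open>t\<close> in the tree
  without leaves; as \<open>t \<ge> 1\<close>, each of the two ends can be prolonged independently in \<open>m\<close> ways.
\<close>

lemma card_pairs_at_interior:
  assumes "1 \<le> t"
  shows "card (pairs_at V d (t + 2)) = m ^ 2 * card (pairs_at interior d t)"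
proof -
  have "card {(u, x). u \<in> interior \<and> x \<in> V \<and> d u x = t + 1} = m * card (pairs_at interior d t)"
    using card_pairs_extend[OF interior_subset assms] by (simp add: pairs_at_def)
  then show ?thesis using card_pairs_at_Suc[of "t + 1"] assms by (simp add: power2_eq_square)
qed

end

text \<open>
  Replacing \<open>(D, t)\<close> by \<open>(D - 2, t - 2)\<close> divides the number of pairs by \<open>m^2\<close>.  It divides the
  difference \<open>V(D) - V(t - 1)\<close> by \<open>m\<close>, because the constant 2 in the recurrence cancels, and it divides the power of
  \<open>m\<close> in front of it by \<open>m\<close>.  So the formula descends to \<open>t = 1\<close>, where it is the handshake count,
  and to \<open>t = 2\<close>, where it counts pairs of distinct neighbours of an interior vertex.  The factor 2 against the
  unordered count comes from the two orders of each pair.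
\<close>

lemma card_pairs_at_perfect:
  assumes "perfect_tree_metric V d m D" "1 \<le> t" "t \<le> D"
  shows "real (card (pairs_at V d t)) =
    (if odd t then 2 * real m ^ ((t - 1) div 2) else (real m + 1) * real m ^ (t div 2 - 1))
      * (real (perfect_size m D) - real (perfect_size m (t - 1)))"
  using assms
proof (induction t arbitrary: D V rule: less_induct)
  case (less t)
  interpret perfect_tree_metric V d m D by (rule less)
  have D: "1 \<le> D" using less by simp
  have size: "card V = perfect_size m D" by (rule card_perfect) (rule less)
  consider "t = 1" | "t = 2" | s where "t = s + 2" "1 \<le> s"
    using less.prems by (metis One_nat_def Suc_1 add_2_eq_Suc' le_Suc_ex less_one nat_less_le not_less_eq_eq One_nat_def add.commute)
  then show ?case
  proof cases
    case 1
    have "1 \<le> card V" using nonempty finite_V by (simp add: Suc_leI card_gt_0_iff)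
    then show ?thesis using card_pairs_at_1 1 size by (simp add: of_nat_diff)
  next
    case 2
    have "real (perfect_size m D) = m * real (card interior) + 2"
      using card_eq[OF D] size by simp
    then show ?thesis using card_pairs_at_2 2 by (simp add: algebra_simps)
  next
    case (3 s)
    obtain E where E: "D = Suc (Suc E)" using 3 less.prems by (metis add_2_eq_Suc' le_Suc_ex add.commute add.left_commute)
    obtain r where r: "s = Suc r" using 3 by (metis le_Suc_ex plus_1_eq_Suc)
    have "perfect_tree_metric interior d m E" using perfect_interior E by simp
    then have "real (card (pairs_at interior d s)) =
      (if odd s then 2 * real m ^ ((s - 1) div 2) else (real m + 1) * real m ^ (s div 2 - 1))
        * (real (perfect_size m E) - real (perfect_size m (s - 1)))"
      using less.IH[of s] 3 less.prems E by simp
    then have "real (card (pairs_at V d t)) = real m ^ 2 * (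
      (if odd s then 2 * real m ^ ((s - 1) div 2) else (real m + 1) * real m ^ (s div 2 - 1))
        * (real (perfect_size m E) - real (perfect_size m (s - 1))))"
      using card_pairs_at_interior[OF 3(2)] 3(1) by simp
    moreover have "real (perfect_size m D) - real (perfect_size m (t - 1))
        = real m * (real (perfect_size m E) - real (perfect_size m (s - 1)))"
      using E 3 r by (simp add: algebra_simps)
    moreover have "real m ^ ((t - 1) div 2) = real m * real m ^ ((s - 1) div 2)" if "odd s"
    proof -
      have "(t - 1) div 2 = Suc ((s - 1) div 2)" using that 3 r by auto
      then show ?thesis by simp
    qed
    moreover have "real m ^ (t div 2 - 1) = real m * real m ^ (s div 2 - 1)" if "even s"
    proof -
      have "t div 2 - 1 = Suc (s div 2 - 1)" using that 3 r by (auto elim: evenE)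
      then show ?thesis by simp
    qed
    moreover have "odd t \<longleftrightarrow> odd s" using 3 by simp
    ultimately show ?thesis by (simp add: power2_eq_square)
  qed
qed

section \<open>The distance in a tree is a tree metric\<close>

locale undirected_tree_graph = pair_graph +
  assumes conn: "connected (with_proj G)"
    and acyclic: "cycle p \<Longrightarrow> length p < 3"

lemma undirected_tree_iff: "undirected_tree T \<longleftrightarrow> undirected_tree_graph T"
  by (auto simp: undirected_tree_def undirected_tree_graph_def undirected_tree_graph_axioms_def
      not_less[symmetric])

context undirected_tree_graph begin

lemma apath_exists:
  assumes "u \<in> pverts G" "v \<in> pverts G"
  shows "\<exists>p. apath u p v"
proof -
  have "u \<rightarrow>\<^sup>*\<^bsub>mk_symmetric G\<^esub> v"
    using conn assms by (auto simp: connected_def mk_symmetric_def)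
  then have "u \<rightarrow>\<^sup>*\<^bsub>with_proj G\<^esub> v" using reachable_mk_symmetric_eq pair_sym_arcs by blast
  then show ?thesis by (simp add: reachable_apath)
qed

text \<open>
  The only place where acyclicity enters: a walk between distinct neighbours of \<open>u\<close> that avoids \<open>u\<close>
  contains a path between them, and \<open>u\<close> closes this path to a cycle with at least three arcs.
\<close>

lemma nbr_unique:
  assumes "(u, w1) \<in> parcs G" "(u, w2) \<in> parcs G" "awalk w1 p w2" "u \<notin> set (pawalk_verts w1 p)"
  shows "w1 = w2"
proof (rule ccontr)
  assume ne: "w1 \<noteq> w2"
  define q where "q = awalk_to_apath p"
  have q: "apath w1 q w2" "set q \<subseteq> set p"
    unfolding q_def using assms(3) apath_awalk_to_apath awalk_to_apath_subset by blast+
  have "q \<noteq> []" "p \<noteq> []" using ne q assms(3) by (auto simp: apath_Nil_iff awalk_Nil_iff)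
  then have uq: "u \<notin> set (pawalk_verts w1 q)"
    using q assms(3,4) set_awalk_verts_not_Nil[of w1 p w2] set_awalk_verts_not_Nil[of w1 q w2]
    by (auto simp: apath_def)
  define c where "c = (u, w1) # q @ [(w2, u)]"
  have "(w2, u) \<in> parcs G" using assms(2) arcs_symmetric by simp
  moreover have "u \<in> pverts G" using assms in_arcsD1 by blast
  ultimately have "awalk w2 [(w2, u)] u" by (simp add: awalk_simps)
  then have w: "awalk w1 (q @ [(w2, u)]) u"
    using awalk_appendI[OF awalkI_apath[OF q(1)]] by blast
  then have "awalk u c u"
    unfolding c_def awalk_Cons_iff using assms(1) by simp
  moreover have "tl (pawalk_verts u c) = pawalk_verts w1 q @ [u]"
    using awalk_verts_append[OF w] q(1) by (auto simp: c_def apath_def)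
  then have "distinct (tl (pawalk_verts u c))" using q(1) uq by (simp add: apath_def)
  ultimately have "cycle c" by (auto simp: cycle_def c_def)
  moreover have "3 \<le> length c" using \<open>q \<noteq> []\<close> by (cases q) (auto simp: c_def)
  ultimately show False using acyclic by fastforce
qed

text \<open>
  The first steps of two paths from \<open>u\<close> to \<open>v\<close> lead to neighbours of \<open>u\<close> that are joined by the rest of one
  path and the reversed rest of the other, which both avoid \<open>u\<close>; so they agree.
\<close>

lemma apath_unique:
  assumes "apath u p v" "apath u q v"
  shows "p = q"
  using assms
proof (induction p arbitrary: u q)
  case Nil
  then show ?case using apath_nonempty_ends[of u q v] by (auto simp: apath_Nil_iff)
next
  case (Cons e p)
  have "u \<noteq> v" using apath_nonempty_ends[OF Cons.prems(1)] by simp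
  then obtain f r where q: "q = f # r" using Cons.prems(2) by (cases q) (auto simp: apath_Nil_iff)
  obtain a b where ef: "e = (u, a)" "f = (u, b)"
    using Cons.prems q by (cases e, cases f) (auto simp: apath_Cons_iff)
  have p: "apath a p v" "u \<notin> set (pawalk_verts a p)" "(u, a) \<in> parcs G"
    and r: "apath b r v" "u \<notin> set (pawalk_verts b r)" "(u, b) \<in> parcs G"
    using Cons.prems q ef by (auto simp: apath_Cons_iff)
  have w: "awalk a p v" "awalk v (rev_path r) b" "awalk b r v" using p r by (auto simp: apath_def)
  have "set (pawalk_verts a (p @ rev_path r)) = set (pawalk_verts a p) \<union> set (pawalk_verts b r)"
    using set_awalk_verts_append[OF w(1,2)] awalk_verts_rev_path[OF w(3)] by simp
  then have "a = b" using nbr_unique[OF p(3) r(3) awalk_appendI[OF w(1,2)]] p r by simp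
  then show ?case using Cons.IH[of a r] p r q ef by simp
qed

lemma tree_dist_eq: "apath u p v \<Longrightarrow> tree_dist G u v = length p"
  unfolding tree_dist_def using apath_unique by (metis the_equality)

lemma tree_dist_1_iff:
  assumes "u \<in> pverts G" "v \<in> pverts G"
  shows "tree_dist G u v = 1 \<longleftrightarrow> (u, v) \<in> parcs G"
proof
  assume "(u, v) \<in> parcs G"
  then have "apath u [(u, v)] v"
    using assms pair_no_loops by (fastforce simp: apath_simps)
  then show "tree_dist G u v = 1" using tree_dist_eq by fastforce
next
  assume 1: "tree_dist G u v = 1"
  obtain p where p: "apath u p v" using apath_exists assms by blast
  then have "length p = 1" using tree_dist_eq 1 by simp
  then obtain e where "p = [e]" by (cases p) auto
  then show "(u, v) \<in> parcs G" using p by (cases e) (auto simp: apath_simps)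
qed

lemma tree_dist_of_arc:
  assumes "(v, w) \<in> parcs G"
  shows "tree_dist G w v = 1" "tree_dist G v v = 0"
proof -
  have V: "v \<in> pverts G" "w \<in> pverts G" using assms in_arcsD1 in_arcsD2 by blast+
  show "tree_dist G w v = 1" using assms V tree_dist_1_iff arcs_symmetric by simp
  have "apath v [] v" using V by (simp add: apath_Nil_iff)
  then show "tree_dist G v v = 0" using tree_dist_eq by fastforce
qed

text \<open>
  Let \<open>w\<close> be the next vertex on the path from \<open>u\<close> to \<open>v\<close>.  By \<open>nbr_unique\<close>, no other neighbour \<open>x\<close> of \<open>u\<close>
  lies on this path, so prefixing the arc from \<open>x\<close> to \<open>u\<close> yields again a path.
\<close>

lemma tree_dist_arc_cases:
  assumes "u \<in> pverts G" "v \<in> pverts G" "u \<noteq> v"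
  shows "\<exists>w. (u, w) \<in> parcs G \<and> tree_dist G u v = tree_dist G w v + 1 \<and>
             (\<forall>x. (u, x) \<in> parcs G \<longrightarrow> x \<noteq> w \<longrightarrow> tree_dist G x v = tree_dist G u v + 1)"
proof -
  obtain p where p: "apath u p v" using apath_exists assms by blast
  then obtain w q where q: "p = (u, w) # q"
    using assms by (cases p) (auto simp: apath_simps)
  have w: "(u, w) \<in> parcs G" "apath w q v" "u \<notin> set (pawalk_verts w q)"
    using p q by (auto simp: apath_Cons_iff)
  show ?thesis
  proof (intro exI[of _ w] conjI allI impI)
    show "(u, w) \<in> parcs G" by (rule w)
    show "tree_dist G u v = tree_dist G w v + 1"
      using tree_dist_eq[OF p] tree_dist_eq[OF w(2)] q by simp
    fix x assume x: "(u, x) \<in> parcs G" "x \<noteq> w"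
    have "x \<notin> set (pawalk_verts w q)"
    proof
      assume "x \<in> set (pawalk_verts w q)"
      then obtain r s where rs: "q = r @ s" "awalk w r x" "awalk x s v"
        using awalk_decomp[of w q v x] w(2) by (auto simp: apath_def)
      then have "u \<notin> set (pawalk_verts w r)"
        using set_awalk_verts_append[OF rs(2,3)] w(3) by simp
      then show False using nbr_unique[OF w(1) x(1) rs(2)] x(2) by simp
    qed
    then have "apath x ((x, u) # p) v"
      using p q x pair_no_loops arcs_symmetric by (fastforce simp: apath_Cons_iff)
    then show "tree_dist G x v = tree_dist G u v + 1"
      using tree_dist_eq[OF p] tree_dist_eq by fastforce
  qed
qed

lemma tree_metric: "tree_metric (pverts G) (tree_dist G)"
proof
  show "finite (pverts G)" by (rule pair_finite_verts)
  show "pverts G \<noteq> {}" using conn by (auto simp: connected_def strongly_connected_def mk_symmetric_def)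
  show refl: "tree_dist G v v = 0" if "v \<in> pverts G" for v
  proof -
    have "apath v [] v" using that by (simp add: apath_Nil_iff)
    then show ?thesis using tree_dist_eq by fastforce
  qed
  show "tree_dist G u v = tree_dist G v u" if uv: "u \<in> pverts G" "v \<in> pverts G" for u v
  proof -
    obtain p where p: "apath u p v" using apath_exists uv by blast
    then have "apath v (rev_path p) u" by simp
    moreover have "length (rev_path p) = length p" by (induction p) auto
    ultimately show ?thesis using tree_dist_eq p by metis
  qed
  show "\<exists>!w. w \<in> pverts G \<and> tree_dist G u w = 1 \<and> tree_dist G u v = tree_dist G w v + 1"
    if uv: "u \<in> pverts G" "v \<in> pverts G" "u \<noteq> v" for u v
  proof -
    obtain w where w: "(u, w) \<in> parcs G" "tree_dist G u v = tree_dist G w v + 1"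
      and far: "\<And>x. (u, x) \<in> parcs G \<Longrightarrow> x \<noteq> w \<Longrightarrow> tree_dist G x v = tree_dist G u v + 1"
      using tree_dist_arc_cases[OF uv] by blast
    show ?thesis
    proof (rule ex1I[of _ w])
      show "w \<in> pverts G \<and> tree_dist G u w = 1 \<and> tree_dist G u v = tree_dist G w v + 1"
        using w uv(1) in_arcsD2 tree_dist_1_iff by blast
      show "x = w" if "x \<in> pverts G \<and> tree_dist G u x = 1 \<and> tree_dist G u v = tree_dist G x v + 1" for x
        using far[of x] tree_dist_1_iff[OF uv(1), of x] that by fastforce
    qed
  qed
  show "tree_dist G w v = tree_dist G u v + 1 \<or> tree_dist G u v = tree_dist G w v + 1"
    if V: "u \<in> pverts G" "v \<in> pverts G" "w \<in> pverts G" and uw1: "tree_dist G u w = 1" for u v w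
  proof -
    have uw: "(u, w) \<in> parcs G" using tree_dist_1_iff[OF V(1,3)] uw1 by blast
    show ?thesis
    proof (cases "u = v")
      case True
      then show ?thesis using tree_dist_of_arc uw by simp
    next
      case False
      then show ?thesis using tree_dist_arc_cases[OF V(1,2)] uw by metis
    qed
  qed
qed

end

section \<open>Every tree metric is the distance in a tree\<close>

context tree_metric begin

definition adjacency_graph :: "'a pair_pre_digraph" where
  "adjacency_graph = \<lparr> pverts = V, parcs = {(u, v). u \<in> V \<and> v \<in> V \<and> d u v = 1} \<rparr>"

lemma adjacency_graph_simps [simp]:
  "pverts adjacency_graph = V"
  "(u, v) \<in> parcs adjacency_graph \<longleftrightarrow> u \<in> V \<and> v \<in> V \<and> d u v = 1"
  by (simp_all add: adjacency_graph_def)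

lemma pair_adjacency_graph: "pair_graph adjacency_graph"
proof
  show "fst e \<in> pverts adjacency_graph" "snd e \<in> pverts adjacency_graph" if "e \<in> parcs adjacency_graph" for e
    using that by (cases e; simp)+
  show "finite (pverts adjacency_graph)" using finite_V by simp
  have "parcs adjacency_graph \<subseteq> V \<times> V" by auto
  then show "finite (parcs adjacency_graph)" using finite_V finite_subset by blast
  show "fst e \<noteq> snd e" if "e \<in> parcs adjacency_graph" for e
    using that dist_refl by (cases e) auto
  show "symmetric (with_proj adjacency_graph)"
    using dist_sym by (auto simp: symmetric_def intro!: symI)
qed

sublocale T: pair_graph adjacency_graph by (rule pair_adjacency_graph)

lemma awalk_exists:
  assumes "u \<in> V" "v \<in> V"
  shows "\<exists>p. T.awalk u p v"
  using assms
proof (induction "d u v" arbitrary: u)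
  case 0
  then show ?case using dist_eq_0[of u v] by (auto simp: T.awalk_Nil_iff intro: exI[of _ "[]"])
next
  case (Suc n)
  then have "u \<noteq> v" using dist_refl by auto
  then obtain w where w: "w \<in> nbrs u" "d u v = d w v + 1" using ex_toward Suc by blast
  then obtain p where "T.awalk w p v" using Suc nbrs_in_V by fastforce
  then have "T.awalk u ((u, w) # p) v"
    using w Suc.prems by (auto simp: T.awalk_Cons_iff nbrs_def)
  then show ?case by blast
qed

text \<open>
  A path whose first step leads away from \<open>u\<close> leads away from \<open>u\<close> forever: at each later vertex the
  unique neighbour closer to \<open>u\<close> is the one the path has just come from.  Hence a path cannot return
  to \<open>u\<close>, and there are no cycles.
\<close>

lemma apath_outward:
  assumes "T.apath a p c" "p = (a, b) # q" "d u b = d u a + 1" "u \<in> V"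
  shows "d u c = d u a + length p"
  using assms
proof (induction q arbitrary: a b p)
  case Nil
  then show ?case by (auto simp: T.apath_simps)
next
  case (Cons e q)
  obtain x where e: "e = (b, x)" using Cons.prems by (cases e) (auto simp: T.apath_simps)
  have V: "a \<in> V" "b \<in> V" "x \<in> V" "d a b = 1" "d b x = 1"
    using Cons.prems e by (auto simp: T.apath_simps)
  have "T.apath x q c" using Cons.prems e by (auto simp: T.apath_Cons_iff)
  then have "x \<in> set (pawalk_verts x q)" by (rule T.hd_in_awalk_verts(2))
  then have "x \<noteq> a" using Cons.prems e by (auto simp: T.apath_simps T.hd_in_awalk_verts)
  have "b \<noteq> u" using Cons.prems dist_refl by auto
  have "d b a = 1" "d b u = d a u + 1" using V Cons.prems dist_sym by auto
  then have "d x u \<noteq> d b u - 1" using toward[of b u] V \<open>x \<noteq> a\<close> \<open>b \<noteq> u\<close> Cons.prems by auto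
  then have "d x u = d b u + 1" using step[of b u x] V Cons.prems by auto
  then have "d u x = d u b + 1" using V Cons.prems dist_sym by auto
  then have "d u c = d u b + length (e # q)"
    using Cons.IH[of b "e # q" x] Cons.prems e by (auto simp: T.apath_Cons_iff)
  then show ?case using Cons.prems by simp
qed

lemma undirected_tree_graph: "undirected_tree_graph adjacency_graph"
proof
  have "u \<rightarrow>\<^sup>*\<^bsub>mk_symmetric adjacency_graph\<^esub> v" if "u \<in> V" "v \<in> V" for u v
    using awalk_exists[OF that] T.reachable_mk_symmetric_eq[OF T.pair_sym_arcs] T.reachable_awalk by blast
  then show "connected (with_proj adjacency_graph)"
    using nonempty unfolding connected_def strongly_connected_def
    by (auto simp: mk_symmetric_def)
  show "length c < 3" if cyc: "T.cycle c" for c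
  proof (rule ccontr)
    assume "\<not> length c < 3"
    then obtain e f g r where c: "c = e # f # g # r"
      by (cases c; cases "tl c"; cases "tl (tl c)") auto
    obtain u where u: "T.awalk u c u" "distinct (tl (pawalk_verts u c))"
      using cyc by (auto simp: T.cycle_def)
    \<comment> \<open>The first step of the cycle leads away from \<open>u\<close>, and so does the second, since \<open>b \<noteq> u\<close>.\<close>
    obtain a b x where efg: "e = (u, a)" "f = (a, b)" "g = (b, x)"
      using u c by (cases e, cases f, cases g) (auto simp: T.awalk_simps)
    have p: "T.apath a (f # g # r) u"
      using u c efg by (auto simp: T.apath_def T.awalk_Cons_iff)
    have V: "u \<in> V" "a \<in> V" "b \<in> V" "d u a = 1" "d a b = 1"
      using u c efg by (auto simp: T.awalk_Cons_iff)
    have "u \<in> set (pawalk_verts x r)" using p efg by (auto simp: T.apath_Cons_iff T.apath_def)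
    then have "b \<noteq> u" using p efg by (auto simp: T.apath_Cons_iff)
    have "d b u \<noteq> 0" using V dist_eq_0 \<open>b \<noteq> u\<close> by simp
    then have "d b u = d a u + 1" using step[of a u b] V dist_sym[of a u] by auto
    then have "d u b = d u a + 1" using V dist_sym by simp
    then have "d u u = d u a + length (f # g # r)" using apath_outward[OF p] efg V by blast
    then show False using V dist_refl by simp
  qed
qed

end

text \<open>
  Follow a shortest route for \<open>d\<close>: each of its steps changes \<open>d'\<close> by exactly 1.
\<close>

lemma tree_metric_le:
  assumes "tree_metric V d" "tree_metric V d'"
    and adj: "\<And>u v. u \<in> V \<Longrightarrow> v \<in> V \<Longrightarrow> d u v = 1 \<Longrightarrow> d' u v = 1"
    and V: "u \<in> V" "v \<in> V"
  shows "d' u v \<le> d u v"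
proof -
  interpret d: tree_metric V d by (rule assms)
  interpret d': tree_metric V d' by (rule assms)
  show ?thesis using V(1)
  proof (induction "d u v" arbitrary: u)
    case 0
    then have "u = v" using d.dist_eq_0 V(2) by simp
    then show ?case using d'.dist_refl V(2) by simp
  next
    case (Suc n)
    then have "u \<noteq> v" using d.dist_refl[OF V(2)] by auto
    then obtain w where w: "w \<in> V" "d u w = 1" "d u v = d w v + 1"
      using d.toward[OF Suc.prems V(2)] by blast
    then have "d' w v \<le> d w v" using Suc.hyps by simp
    moreover have "d' u w = 1" using adj Suc.prems w by blast
    then have "d' w v = d' u v + 1 \<or> d' u v = d' w v + 1"
      using d'.step Suc.prems V(2) w(1) by blast
    ultimately show ?case using w by linarith
  qed
qed

lemma tree_metric_unique:
  assumes "tree_metric V d" "tree_metric V d'"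
    and adj: "\<And>u v. u \<in> V \<Longrightarrow> v \<in> V \<Longrightarrow> d u v = 1 \<longleftrightarrow> d' u v = 1"
    and V: "u \<in> V" "v \<in> V"
  shows "d u v = d' u v"
  using tree_metric_le[OF assms(1,2) _ V] tree_metric_le[OF assms(2,1) _ V] adj
  by (meson le_antisym)

lemma (in tree_metric) tree_dist_adjacency_graph:
  assumes "u \<in> V" "v \<in> V"
  shows "tree_dist adjacency_graph u v = d u v"
proof -
  interpret G: undirected_tree_graph adjacency_graph by (rule undirected_tree_graph)
  show ?thesis
  proof (rule tree_metric_unique[OF _ _ _ assms])
    show "tree_metric V (tree_dist adjacency_graph)" using G.tree_metric by simp
    show "tree_metric V d" by unfold_locales
    show "tree_dist adjacency_graph u v = 1 \<longleftrightarrow> d u v = 1" if "u \<in> V" "v \<in> V" for u v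
      using that G.tree_dist_1_iff by simp
  qed
qed

section \<open>Existence of perfect trees\<close>

text \<open>
  The inverse of the removal of leaves: new vertices \<open>N\<close> are attached, \<open>x\<close> as a neighbour of \<open>p x\<close>.
\<close>

locale leaf_attachment = tree_metric +
  fixes N :: "'a set" and p :: "'a \<Rightarrow> 'a"
  assumes finite_N: "finite N" and fresh: "N \<inter> V = {}" and p_in_V: "x \<in> N \<Longrightarrow> p x \<in> V"
begin

definition base :: "'a \<Rightarrow> 'a" where
  "base x = (if x \<in> N then p x else x)"

definition attach :: "'a \<Rightarrow> 'a \<Rightarrow> nat" where
  "attach x y = (if x = y then 0
     else d (base x) (base y) + of_bool (x \<in> N) + of_bool (y \<in> N))"

lemma base_in_V: "x \<in> V \<union> N \<Longrightarrow> base x \<in> V"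
  using p_in_V by (auto simp: base_def)

lemma notin_V: "x \<in> N \<Longrightarrow> x \<notin> V"
  using fresh by blast

lemma p_notin_N: "x \<in> N \<Longrightarrow> p x \<notin> N"
  using notin_V[of "p x"] p_in_V[of x] by auto

lemma p_neq: "x \<in> N \<Longrightarrow> x \<noteq> p x"
  using p_notin_N[of x] by metis

lemma attach_V: "u \<in> V \<Longrightarrow> v \<in> V \<Longrightarrow> attach u v = d u v"
  using fresh dist_refl by (auto simp: attach_def base_def)

lemma attach_N_V: "x \<in> N \<Longrightarrow> v \<in> V \<Longrightarrow> attach x v = d (p x) v + 1"
  using fresh by (auto simp: attach_def base_def)

lemma attach_V_N: "x \<in> N \<Longrightarrow> v \<in> V \<Longrightarrow> attach v x = d v (p x) + 1"
  using fresh by (auto simp: attach_def base_def)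

lemma attach_N: "x \<in> N \<Longrightarrow> y \<in> N \<Longrightarrow> x \<noteq> y \<Longrightarrow> attach x y = d (p x) (p y) + 2"
  by (auto simp: attach_def base_def)

lemmas attach_simps = attach_V attach_N_V attach_V_N attach_N

lemma attach_sym:
  assumes "x \<in> V \<union> N" "y \<in> V \<union> N"
  shows "attach x y = attach y x"
  using dist_sym[OF base_in_V base_in_V] assms by (simp add: attach_def)

lemma attach_1_iff:
  assumes "x \<in> V \<union> N" "y \<in> V \<union> N"
  shows "attach x y = 1 \<longleftrightarrow>
    x \<in> V \<and> y \<in> V \<and> d x y = 1 \<or> x \<in> N \<and> y = p x \<or> y \<in> N \<and> x = p y"
proof -
  consider "x = y" | "x \<noteq> y" "x \<in> V" "y \<in> V" | "x \<noteq> y" "x \<in> N" "y \<in> V"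
    | "x \<noteq> y" "x \<in> V" "y \<in> N" | "x \<noteq> y" "x \<in> N" "y \<in> N"
    using assms by blast
  then show ?thesis
  proof cases
    case 1
    have "attach x x = 0" by (simp add: attach_def)
    moreover have "\<not> (x \<in> V \<and> d x x = 1)" using dist_refl by auto
    ultimately show ?thesis using 1 p_neq by (metis zero_neq_one)
  next
    case 2
    then show ?thesis using notin_V[of x] notin_V[of y] by (auto simp: attach_V)
  next
    case 3
    then show ?thesis using notin_V[of x] notin_V[of y] dist_eq_0[OF p_in_V[OF 3(2)] 3(3)]
      by (auto simp: attach_N_V)
  next
    case 4
    then show ?thesis using notin_V[of x] notin_V[of y] dist_eq_0[OF 4(2) p_in_V[OF 4(3)]]
      by (auto simp: attach_V_N)
  next
    case 5
    then show ?thesis using notin_V[of x] notin_V[of y] p_notin_N[of x] p_notin_N[of y]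
      by (auto simp: attach_N)
  qed
qed

lemma attach_leaf:
  assumes "x \<in> N" "v \<in> V \<union> N" "v \<noteq> x"
  shows "attach x v = attach (p x) v + 1"
proof (cases "v \<in> N")
  case True
  then show ?thesis using assms p_in_V[OF assms(1)] by (simp add: attach_N attach_V_N)
next
  case False
  then show ?thesis using assms p_in_V[OF assms(1)] by (simp add: attach_N_V attach_V)
qed

lemma tree_metric_attach: "tree_metric (V \<union> N) attach"
proof
  show "finite (V \<union> N)" using finite_V finite_N by simp
  show "V \<union> N \<noteq> {}" using nonempty by simp
  show "attach v v = 0" for v by (simp add: attach_def)
  show "attach u v = attach v u" if "u \<in> V \<union> N" "v \<in> V \<union> N" for u v
    using attach_sym that .
  have away: "attach w v = attach u v + 1"
    if "w \<in> N" "u = p w" "v \<in> V \<union> N" "v \<noteq> w" for u v w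
    using attach_leaf that by blast
  show "attach w v = attach u v + 1 \<or> attach u v = attach w v + 1"
    if uvw: "u \<in> V \<union> N" "v \<in> V \<union> N" "w \<in> V \<union> N" and 1: "attach u w = 1" for u v w
  proof -
    consider "u \<in> V" "w \<in> V" "d u w = 1" | "u \<in> N" "w = p u" | "w \<in> N" "u = p w"
      using 1 attach_1_iff uvw by blast
    then show ?thesis
    proof cases
      case a: 1
      show ?thesis
      proof (cases "v \<in> N")
        case True
        then show ?thesis
          using step[OF a(1) p_in_V[OF True] a(2,3)] a by (auto simp: attach_simps)
      next
        case False
        then show ?thesis using step[OF a(1) _ a(2,3), of v] uvw a by (auto simp: attach_simps)
      qed
    next
      case 2
      have "attach w u = 1" using 1 attach_sym uvw by simp
      then show ?thesis
        using 2 away[of u w v] uvw by (cases "v = u") (auto simp: attach_def)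
    next
      case 3
      then show ?thesis
        using 1 away[of w u v] uvw by (cases "v = w") (auto simp: attach_def)
    qed
  qed
  show "\<exists>!w. w \<in> V \<union> N \<and> attach u w = 1 \<and> attach u v = attach w v + 1"
    if uv: "u \<in> V \<union> N" "v \<in> V \<union> N" "u \<noteq> v" for u v
  proof -
    consider "u \<in> N" | "u \<in> V" "v \<in> N" "p v = u" | "u \<in> V" "base v \<noteq> u"
    proof -
      have "v \<in> N \<and> p v = u" if "base v = u"
        using that uv(3) by (auto simp: base_def split: if_splits)
      then show ?thesis using that uv by blast
    qed
    then show ?thesis
    proof cases
      case 1
      have "attach u w = 1 \<longleftrightarrow> w = p u" if "w \<in> V \<union> N" for w
        using attach_1_iff[OF uv(1) that] 1 fresh p_in_V by blast
      moreover have "attach u v = attach (p u) v + 1" using away 1 uv by metis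
      ultimately show ?thesis using p_in_V[OF 1] by (intro ex1I[of _ "p u"]) auto
    next
      case 2
      have "attach u v = 1" using attach_1_iff uv 2 by blast
      moreover have "attach w v = 0 \<longleftrightarrow> w = v" if "w \<in> V \<union> N" for w
        using 2 that by (auto simp: attach_def)
      ultimately show ?thesis using uv by (intro ex1I[of _ v]) auto
    next
      case 3
      have b: "base v \<in> V" using base_in_V uv by blast
      have eq: "attach w v = d w (base v) + of_bool (v \<in> N)" if "w \<in> V" for w
        using that uv fresh dist_refl by (auto simp: attach_def base_def)
      obtain w where w: "w \<in> V" "d u w = 1" "d u (base v) = d w (base v) + 1"
        and uniq: "\<And>x. x \<in> V \<Longrightarrow> d u x = 1 \<Longrightarrow> d u (base v) = d x (base v) + 1 \<Longrightarrow> x = w"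
        using toward[OF 3(1) b] 3(2) by metis
      show ?thesis
      proof (rule ex1I[of _ w])
        show "w \<in> V \<union> N \<and> attach u w = 1 \<and> attach u v = attach w v + 1"
          using w 3 eq by (simp add: attach_V)
        show "x = w" if x: "x \<in> V \<union> N \<and> attach u x = 1 \<and> attach u v = attach x v + 1" for x
        proof (cases "x \<in> N")
          case True
          then have px: "u = p x" using attach_1_iff[OF uv(1), of x] x fresh 3 by blast
          have "v \<noteq> x" using px True 3 by (auto simp: base_def)
          then show ?thesis using away[OF True px uv(2)] x by simp
        next
          case False
          then have xV: "x \<in> V" using x by simp
          then have "d u x = 1" using x 3 attach_V by simp
          then show ?thesis using x uniq[OF xV] eq[OF xV] eq[OF 3(1)] by simp
        qed
      qed
    qed
  qed
qed

sublocale att: tree_metric "V \<union> N" attach by (rule tree_metric_attach)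

lemma attach_nbrs_V:
  assumes "v \<in> V"
  shows "att.nbrs v = nbrs v \<union> {x \<in> N. p x = v}"
  using attach_1_iff[of v] assms fresh by (auto simp: att.nbrs_def nbrs_def)

lemma attach_nbrs_N:
  assumes "x \<in> N"
  shows "att.nbrs x = {p x}"
  using attach_1_iff[of x] assms notin_V[OF assms] p_in_V[OF assms] p_notin_N
  by (auto simp: att.nbrs_def simp del: One_nat_def)

end

text \<open>
  Every vertex gets as many new neighbours as its degree falls short of \<open>m + 1\<close>.  This affects
  only the vertices of degree at most 1, which are ends of longest paths; so the path from a new
  vertex \<open>x\<close> to some new vertex at the far end has length \<open>D + 2\<close>.
\<close>

lemma (in perfect_tree_metric) perfect_attach:
  assumes "leaf_attachment V d N p"
    and missing: "\<And>v. v \<in> V \<Longrightarrow> card {x \<in> N. p x = v} = m + 1 - card (nbrs v)"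
  shows "\<exists>d'. perfect_tree_metric (V \<union> N) d' m (D + 2)"
proof -
  interpret leaf_attachment V d N p by (rule assms)
  have leaf_parent: "\<exists>w\<in>V. d (p x) w = D" if "x \<in> N" for x
  proof -
    have "0 < card {y \<in> N. p y = p x}" using that finite_N by (auto simp: card_gt_0_iff)
    then show ?thesis
      using missing[OF p_in_V[OF that]] degrees[OF p_in_V[OF that]] by auto
  qed
  have far: "\<exists>y\<in>N. attach x y = D + 2" if x: "x \<in> N" for x
  proof -
    obtain w where w: "w \<in> V" "d (p x) w = D" using leaf_parent x by blast
    have "card (nbrs w) \<le> 1"
      using end_degree[OF w(1) p_in_V[OF x]] w dist_sym p_in_V[OF x] by simp
    \<comment> \<open>Two new vertices at \<open>w\<close> are needed when \<open>D = 0\<close>, as then \<open>w = p x\<close> and \<open>x\<close> is one of them.\<close>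
    then have "2 \<le> card {y \<in> N. p y = w}" using missing[OF w(1)] two_le_m by simp
    then have "\<not> {y \<in> N. p y = w} \<subseteq> {x}" using card_mono[of "{x}" "{y \<in> N. p y = w}"] by auto
    then obtain y where "y \<in> N" "p y = w" "y \<noteq> x" by blast
    then show ?thesis using attach_N[OF x] w by force
  qed
  have "perfect_tree_metric (V \<union> N) attach m (D + 2)"
  proof
    show "2 \<le> m" by (rule two_le_m)
    show "attach u v \<le> D + 2" if "u \<in> V \<union> N" "v \<in> V \<union> N" for u v
      using bounded[OF base_in_V[OF that(1)] base_in_V[OF that(2)]] by (simp add: attach_def)
    show "card (att.nbrs v) = m + 1 \<or> card (att.nbrs v) \<le> 1 \<and> (\<exists>w\<in>V \<union> N. attach v w = D + 2)"
      if "v \<in> V \<union> N" for v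
    proof (cases "v \<in> N")
      case True
      then show ?thesis using attach_nbrs_N far by fastforce
    next
      case False
      then have v: "v \<in> V" using that by simp
      have "nbrs v \<inter> {x \<in> N. p x = v} = {}" using fresh by (auto simp: nbrs_def)
      then have "card (att.nbrs v) = card (nbrs v) + card {x \<in> N. p x = v}"
        using attach_nbrs_V[OF v] finite_N by (simp add: card_Un_disjoint)
      then show ?thesis using missing[OF v] degrees[OF v] by auto
    qed
    obtain u v where uv: "u \<in> V" "v \<in> V" "d u v = D" using attained by blast
    have "card (nbrs u) \<le> 1" using end_degree uv by blast
    then have "0 < card {y \<in> N. p y = u}" using missing[OF uv(1)] two_le_m by simp
    then obtain x where "x \<in> N" by (auto simp: card_gt_0_iff)
    then show "\<exists>u\<in>V \<union> N. \<exists>v\<in>V \<union> N. attach u v = D + 2" using far by blast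
  qed
  then show ?thesis by blast
qed

lemma ex_fresh_children:
  fixes V :: "nat set"
  assumes "finite V"
  shows "\<exists>N p. finite N \<and> N \<inter> V = {} \<and> (\<forall>x\<in>N. p x \<in> V) \<and> (\<forall>v\<in>V. card {x \<in> N. p x = v} = k v)"
proof -
  obtain K where K: "\<And>v. v \<in> V \<Longrightarrow> v < K"
    using assms unfolding finite_nat_set_iff_bounded by blast
  define f where "f = (\<lambda>a. K + prod_encode a)"
  define N where "N = f ` (SIGMA v : V. {..<k v})"
  define p where "p = (\<lambda>x. fst (prod_decode (x - K)))"
  have pf: "p (f a) = fst a" for a by (simp add: p_def f_def)
  have inj: "inj f" by (rule injI) (simp add: f_def)
  have "{x \<in> N. p x = v} = f ` ({v} \<times> {..<k v})" if "v \<in> V" for v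
    using that pf by (auto simp: N_def)
  then have "card {x \<in> N. p x = v} = k v" if "v \<in> V" for v
    using that card_image[OF inj_on_subset[OF inj], of "{v} \<times> {..<k v}"] by simp
  moreover have "finite N" using assms by (simp add: N_def)
  moreover have "N \<inter> V = {}" using K by (fastforce simp: N_def f_def)
  moreover have "\<forall>x\<in>N. p x \<in> V" using pf by (auto simp: N_def)
  ultimately show ?thesis by blast
qed

lemma perfect_singleton:
  assumes "2 \<le> m"
  shows "perfect_tree_metric {a} (\<lambda>_ _. 0) m 0"
proof -
  interpret tree_metric "{a}" "\<lambda>_ _. 0" by unfold_locales auto
  have deg: "card (nbrs v) \<le> 1" for v by (simp add: nbrs_def)
  show ?thesis
    by unfold_locales (use assms deg in auto)
qed

lemma perfect_edge:
  assumes "2 \<le> m" "a \<noteq> b"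
  shows "perfect_tree_metric {a, b} (\<lambda>u v. if u = v then 0 else 1) m 1"
proof -
  let ?d = "\<lambda>u v. if u = v then 0 else 1 :: nat"
  interpret tree_metric "{a, b}" ?d
    by unfold_locales (use assms in \<open>auto split: if_splits\<close>)
  have "nbrs a \<subseteq> {b}" "nbrs b \<subseteq> {a}" by (auto simp: nbrs_def)
  then have deg: "card (nbrs a) \<le> 1" "card (nbrs b) \<le> 1"
    using card_mono[of "{b}" "nbrs a"] card_mono[of "{a}" "nbrs b"] by auto
  show ?thesis
    by unfold_locales (use assms deg in auto)
qed

lemma ex_perfect_tree_metric:
  assumes "2 \<le> m"
  shows "\<exists>(V :: nat set) d. perfect_tree_metric V d m D"
  using assms
proof (induction m D rule: perfect_size.induct)
  case (1 m)
  then show ?case by (intro exI) (rule perfect_singleton)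
next
  case (2 m)
  then have "perfect_tree_metric {0, 1 :: nat} (\<lambda>u v. if u = v then 0 else 1) m 1"
    by (rule perfect_edge) simp
  then show ?case unfolding One_nat_def by (intro exI)
next
  case (3 m n)
  then obtain V :: "nat set" and d where "perfect_tree_metric V d m n" by blast
  then interpret perfect_tree_metric V d m n .
  obtain N p where N: "finite N" "N \<inter> V = {}" "\<forall>x\<in>N. p x \<in> V"
    "\<forall>v\<in>V. card {x \<in> N. p x = v} = m + 1 - card (nbrs v)"
    using ex_fresh_children[OF finite_V, of "\<lambda>v. m + 1 - card (nbrs v)"] by blast
  then have "leaf_attachment V d N p" by unfold_locales auto
  then obtain d' where "perfect_tree_metric (V \<union> N) d' m (n + 2)"
    using perfect_attach N(4) by blast
  then show ?case by auto
qed

section \<open>The number of paths in a perfect tree\<close>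

lemma (in undirected_tree_graph) vert_degree_eq:
  assumes "v \<in> pverts G"
  shows "vert_degree G v = card (tree_metric.nbrs (pverts G) (tree_dist G) v)"
proof -
  interpret M: tree_metric "pverts G" "tree_dist G" by (rule tree_metric)
  have "out_arcs (with_proj G) v = Pair v ` M.nbrs v"
    using tree_dist_1_iff[OF assms] in_arcsD2 by (auto simp: out_arcs_def M.nbrs_def)
  then show ?thesis by (simp add: out_degree_def card_image inj_on_def)
qed

lemma (in undirected_tree_graph) tree_diameter_eq_iff:
  "tree_diameter G = D \<longleftrightarrow>
    (\<forall>u\<in>pverts G. \<forall>v\<in>pverts G. tree_dist G u v \<le> D) \<and>
    (\<exists>u\<in>pverts G. \<exists>v\<in>pverts G. tree_dist G u v = D)"
proof -
  let ?S = "{tree_dist G u v | u v. u \<in> pverts G \<and> v \<in> pverts G}"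
  have S: "?S = (\<lambda>(u, v). tree_dist G u v) ` (pverts G \<times> pverts G)" by auto
  have "finite ?S" "?S \<noteq> {}"
    using tree_metric.finite_V[OF tree_metric] tree_metric.nonempty[OF tree_metric]
    by (simp_all only: S) auto
  then have "tree_diameter G = D \<longleftrightarrow> D \<in> ?S \<and> (\<forall>a\<in>?S. a \<le> D)"
    unfolding tree_diameter_def by (rule Max_eq_iff)
  also have "D \<in> ?S \<longleftrightarrow> (\<exists>u\<in>pverts G. \<exists>v\<in>pverts G. tree_dist G u v = D)" by blast
  also have "(\<forall>a\<in>?S. a \<le> D) \<longleftrightarrow> (\<forall>u\<in>pverts G. \<forall>v\<in>pverts G. tree_dist G u v \<le> D)" by blast
  finally show ?thesis by (simp only: conj_commute)
qed

text \<open>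
  For \<open>D \<ge> 1\<close> no vertex has degree 0, so degree at most 1 means degree 1; and a vertex at distance
  \<open>D\<close> from \<open>v\<close> is automatically different from \<open>v\<close>.
\<close>

lemma perfect_mary_tree_iff:
  assumes m: "2 \<le> m"
  shows "perfect_mary_tree_of_diameter m D T \<longleftrightarrow>
    undirected_tree T \<and> perfect_tree_metric (pverts T) (tree_dist T) m D"
proof (cases "undirected_tree T")
  case False
  then show ?thesis
    by (auto simp: perfect_mary_tree_of_diameter_def perfect_unrooted_mary_tree_def
        unrooted_mary_tree_def)
next
  case True
  then interpret undirected_tree_graph T by (simp add: undirected_tree_iff)
  interpret M: tree_metric "pverts T" "tree_dist T" by (rule tree_metric)
  have perfect_iff: "perfect_tree_metric (pverts T) (tree_dist T) m D \<longleftrightarrow>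
      tree_diameter T = D \<and> (\<forall>v\<in>pverts T. vert_degree T v = m + 1 \<or>
        vert_degree T v \<le> 1 \<and> (\<exists>w\<in>pverts T. tree_dist T v w = D))"
    using m vert_degree_eq M.tree_metric_axioms
    by (auto simp: perfect_tree_metric_def perfect_tree_metric_axioms_def tree_diameter_eq_iff)
  show ?thesis
  proof (cases "D = 0")
    case D0: True
    have "perfect_tree_metric (pverts T) (tree_dist T) m 0" if one: "card (pverts T) = 1"
    proof -
      obtain a where a: "pverts T = {a}" using one by (rule card_1_singletonE)
      have "M.nbrs a = {}" 
        by (simp only: M.nbrs_def) (use M.dist_refl[of a] a in auto)
      then have deg: "card (M.nbrs v) \<le> 1" if "v \<in> pverts T" for v using that a by simp
      have zero: "tree_dist T u v = 0" if "u \<in> pverts T" "v \<in> pverts T" for u v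
        using that a M.dist_refl[of a] by simp
      show ?thesis
      proof
        show "card (M.nbrs v) = m + 1 \<or> card (M.nbrs v) \<le> 1 \<and> (\<exists>w\<in>pverts T. tree_dist T v w = 0)"
          if "v \<in> pverts T" for v
          using deg zero that by blast
        show "\<exists>u\<in>pverts T. \<exists>v\<in>pverts T. tree_dist T u v = 0" using zero a by blast
      qed (use m zero in simp_all)
    qed
    then show ?thesis
      using True D0 card_perfect by (fastforce simp: perfect_mary_tree_of_diameter_def)
  next
    case D: False
    have pos: "0 < vert_degree T v" if v: "v \<in> pverts T" and diam: "tree_diameter T = D" for v
    proof -
      obtain a b where ab: "a \<in> pverts T" "b \<in> pverts T" "tree_dist T a b = D"
        using tree_diameter_eq_iff[of D] diam by blast
      then have "a \<noteq> b" using D M.dist_refl[OF ab(1)] by auto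
      then show ?thesis
        using M.nbrs_nonempty[OF v ab(1)] M.nbrs_nonempty[OF v ab(2)] vert_degree_eq[OF v] by auto
    qed
    have "w \<noteq> v" if "v \<in> pverts T" "tree_dist T v w = D" for v w
      using that D M.dist_refl[OF that(1)] by auto
    then show ?thesis
      using True D m pos unfolding perfect_iff perfect_mary_tree_of_diameter_def
        perfect_unrooted_mary_tree_def unrooted_mary_tree_def
      by (fastforce simp: le_Suc_eq)
  qed
qed

text \<open>
  The definite description is proper: a perfect tree on natural numbers exists, and all perfect trees
  of the same diameter have the same order.
\<close>

lemma perfect_mary_order_eq:
  assumes m: "2 \<le> m"
  shows "perfect_mary_order m D = perfect_size m D"
proof -
  obtain V :: "nat set" and d where V: "perfect_tree_metric V d m D"
    using ex_perfect_tree_metric[OF m] by blast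
  interpret perfect_tree_metric V d m D by (rule V)
  interpret G: undirected_tree_graph adjacency_graph by (rule undirected_tree_graph)
  have "perfect_tree_metric V (tree_dist adjacency_graph) m D"
  proof -
    interpret M: tree_metric V "tree_dist adjacency_graph" using G.tree_metric by simp
    have "M.nbrs v = nbrs v" if "v \<in> V" for v
      using that tree_dist_adjacency_graph by (auto simp: M.nbrs_def nbrs_def)
    then show ?thesis
      using two_le_m bounded attained degrees tree_dist_adjacency_graph
      by unfold_locales auto
  qed
  then have tree: "perfect_mary_tree_of_diameter m D adjacency_graph"
    using perfect_mary_tree_iff[OF m, of D adjacency_graph] undirected_tree_graph
      undirected_tree_iff[of adjacency_graph] by simp
  show ?thesis
    unfolding perfect_mary_order_def
  proof (rule the_equality)
    show "\<exists>T :: nat pair_pre_digraph. perfect_mary_tree_of_diameter m D T \<and>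
        card (pverts T) = perfect_size m D"
      using tree card_perfect[OF V]
      by (intro exI[of _ adjacency_graph]) simp
    show "n = perfect_size m D"
      if "\<exists>T :: nat pair_pre_digraph. perfect_mary_tree_of_diameter m D T \<and> card (pverts T) = n" for n
      using that perfect_mary_tree_iff[OF m] card_perfect by blast
  qed
qed

lemma (in tree_metric) card_pairs_at_eq:
  assumes "1 \<le> t"
  shows "card (pairs_at V d t) =
    2 * card {{u, v} | u v. u \<in> V \<and> v \<in> V \<and> u \<noteq> v \<and> d u v = t}"
proof -
  let ?E = "{{u, v} | u v. u \<in> V \<and> v \<in> V \<and> u \<noteq> v \<and> d u v = t}"
  let ?F = "\<lambda>e. {(u, v). u \<noteq> v \<and> {u, v} = e}"
  have "pairs_at V d t = (\<Union>e\<in>?E. ?F e)"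
  proof
    show "pairs_at V d t \<subseteq> (\<Union>e\<in>?E. ?F e)"
    proof
      fix x assume "x \<in> pairs_at V d t"
      then obtain u v where x: "x = (u, v)" "u \<in> V" "v \<in> V" "d u v = t"
        by (auto simp: pairs_at_def)
      have "u \<noteq> v" using dist_refl[OF x(2)] x(4) assms by (metis not_one_le_zero)
      then have "{u, v} \<in> ?E" using x by (intro CollectI exI[of _ u] exI[of _ v]) simp
      moreover have "x \<in> ?F {u, v}" using x(1) \<open>u \<noteq> v\<close> by simp
      ultimately show "x \<in> (\<Union>e\<in>?E. ?F e)" by (rule UN_I)
    qed
    show "(\<Union>e\<in>?E. ?F e) \<subseteq> pairs_at V d t"
    proof
      fix x assume "x \<in> (\<Union>e\<in>?E. ?F e)"
      then obtain u v a b where "x = (a, b)" "{a, b} = {u, v}" "u \<in> V" "v \<in> V" "d u v = t"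
        by blast
      then show "x \<in> pairs_at V d t"
        using dist_sym[of u v] by (auto simp: pairs_at_def doubleton_eq_iff)
    qed
  qed
  moreover have "card (\<Union>e\<in>?E. ?F e) = (\<Sum>e\<in>?E. card (?F e))"
  proof (rule card_UN_disjoint)
    have "?E \<subseteq> Pow V" by auto
    then show "finite ?E" using finite_V finite_subset by blast
    show "\<forall>e\<in>?E. finite (?F e)"
    proof
      fix e assume "e \<in> ?E"
      then have "e \<subseteq> V" by blast
      then have "?F e \<subseteq> V \<times> V" by blast
      then show "finite (?F e)" by (rule finite_subset) (simp add: finite_V)
    qed
  qed auto
  moreover have "card (?F e) = 2" if E: "e \<in> ?E" for e
  proof -
    obtain u v where e: "e = {u, v}" "u \<noteq> v" using E by blast
    then have "?F e = {(u, v), (v, u)}" by (auto simp: doubleton_eq_iff)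
    then show ?thesis using e by simp
  qed
  ultimately show ?thesis by simp
qed

theorem theorem1p1:
  fixes m D t :: nat and T :: "'a pair_pre_digraph"
  assumes "m \<ge> 2" and "D \<ge> 1"
    and "perfect_mary_tree_of_diameter m D T"
    and "1 \<le> t" and "t \<le> D"
  shows "real (path_count T t) =
    (if odd t
     then real m ^ ((t - 1) div 2)
            * (real (perfect_mary_order m D) - real (perfect_mary_order m (t - 1)))
     else 1 / 2 * (real m + 1) * real m ^ (t div 2 - 1)
            * (real (perfect_mary_order m D) - real (perfect_mary_order m (t - 1))))"
proof -
  have perfect: "perfect_tree_metric (pverts T) (tree_dist T) m D"
    using assms perfect_mary_tree_iff by blast
  then interpret perfect_tree_metric "pverts T" "tree_dist T" m D .
  have "2 * real (path_count T t) = real (card (pairs_at (pverts T) (tree_dist T) t))"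
    using card_pairs_at_eq[OF assms(4)] by (simp add: path_count_def)
  then show ?thesis
    using card_pairs_at_perfect[OF perfect assms(4,5)]
    by (auto simp: perfect_mary_order_eq[OF assms(1)])
qed

end
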